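(* Let $G$ be a graph on a vertex set $V$ with a partition $V=V_1\cup V_2\cup V_3$ such that $|V_i|=n$ for each $i\in[3]$. If $G$ is cyclically triangle-free, then $|G|\le 5n^2/2+5n$.
   Context: $|G|$ denotes the number of edges. $G$ is cyclically triangle-free (with respect to the partition) if there is no $3$-set spanning a triangle in $G$ that has one vertex in each of $V_1,V_2,V_3$, or two vertices in $V_1$ and one in $V_2$, or two in $V_2$ and one in $V_3$, or two in $V_3$ and one in $V_1$. *)

theory Defs
  imports Complex_Main "HOL-Library.Ramsey"
begin

text \<open>
  A simple graph on a vertex set \<open>V\<close> is given by its edge set \<open>E\<close>, a set of two-element subsets
  of \<open>V\<close>; thus \<open>card E\<close> is its number of edges.
\<close>

definition simple_graph :: "'a set \<Rightarrow> 'a set set \<Rightarrow> bool" where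
  "simple_graph V E \<longleftrightarrow> finite V \<and> E \<subseteq> nsets V 2"

text \<open>
  Empty parts are allowed, unlike in \<open>partition_on\<close>.
\<close>

definition tripartition :: "'a set \<Rightarrow> 'a set \<Rightarrow> 'a set \<Rightarrow> 'a set \<Rightarrow> bool" where
  "tripartition V V1 V2 V3 \<longleftrightarrow>
     V = V1 \<union> V2 \<union> V3 \<and> V1 \<inter> V2 = {} \<and> V1 \<inter> V3 = {} \<and> V2 \<inter> V3 = {}"

definition spans_triangle :: "'a set set \<Rightarrow> 'a set \<Rightarrow> bool" where
  "spans_triangle E T \<longleftrightarrow> card T = 3 \<and> clique T E"

definition cyclically_triangle_free ::
  "'a set set \<Rightarrow> 'a set \<Rightarrow> 'a set \<Rightarrow> 'a set \<Rightarrow> bool" where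
  "cyclically_triangle_free E V1 V2 V3 \<longleftrightarrow>
     \<not> (\<exists>T. spans_triangle E T \<and>
          (card (T \<inter> V1) = 1 \<and> card (T \<inter> V2) = 1 \<and> card (T \<inter> V3) = 1 \<or>
           card (T \<inter> V1) = 2 \<and> card (T \<inter> V2) = 1 \<or>
           card (T \<inter> V2) = 2 \<and> card (T \<inter> V3) = 1 \<or>
           card (T \<inter> V3) = 2 \<and> card (T \<inter> V1) = 1))"

end

theory Submission
  imports Defs
begin

text \<open>
  Zykov symmetrization: if two nonadjacent vertices \<open>x\<close>, \<open>y\<close> of the same part have different
  neighbourhoods and \<open>deg y \<le> deg x\<close>, then replacing \<open>y\<close> and all its twins in that part by copies
  of \<open>x\<close> creates no forbidden triangle and loses no edges. So we may assume that nonadjacent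
  vertices of a part are twins, that is, every part is complete multipartite with classes of twins.
  A vertex of \<open>V2\<close> then sees nothing or exactly one class in \<open>V1\<close>, and likewise from \<open>V3\<close> to \<open>V2\<close>
  and from \<open>V1\<close> to \<open>V3\<close>. Hence the edges between the parts form a functional digraph on the
  classes, which has no directed 3-cycle.

  Let \<open>A\<close>, \<open>B\<close>, \<open>C\<close> be largest classes of \<open>V1\<close>, \<open>V2\<close>, \<open>V3\<close> in the image of this map. Since
  \<open>A \<rightarrow> C \<rightarrow> B \<rightarrow> A\<close> is not a cycle, one of its arcs is missing, say \<open>C \<rightarrow> B\<close>. Up to rotation, either
  all three arcs are missing, or the path \<open>C \<rightarrow> B' \<rightarrow> A' \<rightarrow> C'\<close> satisfies \<open>B' \<noteq> B\<close>, \<open>A' \<noteq> A\<close>,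
  \<open>C' \<noteq> C\<close>. In both cases the six classes bound the number of edges by a quadratic form
  that is at most \<open>5n\<^sup>2/2\<close>.
\<close>

section \<open>Encoding graphs as symmetric relations, and rotational symmetry\<close>

definition trifree :: "'a rel \<Rightarrow> 'a set \<Rightarrow> 'a set \<Rightarrow> 'a set \<Rightarrow> bool" where
  "trifree r A B C \<longleftrightarrow>
     (\<forall>x\<in>A. \<forall>y\<in>B. \<forall>z\<in>C. \<not> ((x, y) \<in> r \<and> (y, z) \<in> r \<and> (x, z) \<in> r))"

text \<open>Every edge occurs as two ordered pairs, so the target for \<open>card r\<close> is
  \<open>5 * n\<^sup>2\<close>. In this encoding neighbourhoods are images under \<open>r\<close>
  and symmetrization is an inverse image.\<close>

locale cyclic_graph =
  fixes r :: "'a rel" and V1 V2 V3 :: "'a set" and n :: nat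
  assumes fin: "finite V1" "finite V2" "finite V3"
    and card: "card V1 = n" "card V2 = n" "card V3 = n"
    and disj: "V1 \<inter> V2 = {}" "V1 \<inter> V3 = {}" "V2 \<inter> V3 = {}"
    and sub: "r \<subseteq> (V1 \<union> V2 \<union> V3) \<times> (V1 \<union> V2 \<union> V3)"
    and sym: "sym r" and irrefl: "irrefl r"
    and tf123: "trifree r V1 V2 V3"
    and tf112: "trifree r V1 V1 V2"
    and tf223: "trifree r V2 V2 V3"
    and tf331: "trifree r V3 V3 V1"

lemma cyclic_graph_rotate:
  assumes "cyclic_graph r V1 V2 V3 n"
  shows "cyclic_graph r V2 V3 V1 n"
proof -
  interpret cyclic_graph r V1 V2 V3 n by fact
  have "trifree r V2 V3 V1"
    using tf123 sym unfolding trifree_def sym_def by blast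
  then show ?thesis
    using fin card disj sub sym irrefl tf112 tf223 tf331
    by unfold_locales (auto simp: Un_ac Int_commute)
qed

section \<open>Symmetrization\<close>

definition twin_closed :: "'a rel \<Rightarrow> 'a set \<Rightarrow> bool" where
  "twin_closed r P \<longleftrightarrow> (\<forall>x\<in>P. \<forall>y\<in>P. (x, y) \<notin> r \<longrightarrow> r `` {x} = r `` {y})"

text \<open>As \<open>T\<close> is independent, the pairs meeting it form a set of size
  \<open>card T * d\<close> together with its converse. Applied before and after symmetrization,
  only \<open>d\<close> differs.\<close>

lemma card_rel_off:
  assumes "finite r" "sym r" "r \<inter> T \<times> T = {}" "finite T" "\<And>t. t \<in> T \<Longrightarrow> card (r `` {t}) = d"
  shows "card r = card (r \<inter> (- T) \<times> (- T)) + 2 * (card T * d)"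
proof -
  let ?a = "r \<inter> T \<times> (- T)" and ?b = "r \<inter> (- T) \<times> T" and ?o = "r \<inter> (- T) \<times> (- T)"
  have eq: "?a = (SIGMA t:T. r `` {t})" using assms(3) by auto
  have f: "finite (r `` {t})" for t using assms(1) by (rule finite_Image)
  have a: "card ?a = card T * d"
    unfolding eq using assms(4,5) f by (subst card_SigmaI) auto
  have "?b = ?a\<inverse>" using assms(2) by (auto dest: symD)
  then have b: "card ?b = card T * d" using a by (metis card_inverse)
  have "r = ?o \<union> (?a \<union> ?b)" using assms(3) by auto
  then have "card r = card (?o \<union> (?a \<union> ?b))" by (rule arg_cong)
  also have "\<dots> = card ?o + card (?a \<union> ?b)"
    using assms(1) by (intro card_Un_disjoint) auto
  also have "card (?a \<union> ?b) = card ?a + card ?b"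
    using assms(1) by (intro card_Un_disjoint) auto
  finally show ?thesis using a b by simp
qed

text \<open>\<open>f\<close> preserves the parts, so it carries a forbidden triangle of the inverse
  image to one of the same type in \<open>r\<close>.\<close>

lemma trifree_inv_image:
  assumes "trifree r A B C" "f ` A \<subseteq> A" "f ` B \<subseteq> B" "f ` C \<subseteq> C"
  shows "trifree (inv_image r f) A B C"
  using assms unfolding trifree_def inv_image_def by blast

context cyclic_graph
begin

abbreviation "V \<equiv> V1 \<union> V2 \<union> V3"

definition "kind p = (p \<in> V1, p \<in> V2, p \<in> V3)"

text \<open>The number of distinct keys is the induction measure. The component \<open>kind\<close>
  separates vertices of different parts with equal neighbourhoods, because only twins within one
  part are moved.\<close>

definition "key s p = (s `` {p}, kind p)"

lemma finite_r: "finite r"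
  using sub fin by (meson finite_SigmaI finite_UnI finite_subset)

lemma symmetrize:
  assumes P: "P \<in> {V1, V2, V3}" and x: "x \<in> P" and y: "y \<in> P"
    and xy: "(x, y) \<notin> r" "r `` {x} \<noteq> r `` {y}"
    and deg: "card (r `` {y}) \<le> card (r `` {x})"
  shows "\<exists>r'. cyclic_graph r' V1 V2 V3 n \<and> card r \<le> card r' \<and>
    card (key r' ` V) < card (key r ` V)"
proof -
  \<comment> \<open>Moving only \<open>y\<close> need not reduce the number of distinct neighbourhoods, so its whole twin
      class is moved.\<close>
  define T where "T = {p \<in> P. r `` {p} = r `` {y}}"
  define f where "f p = (if r `` {p} = r `` {y} \<and> p \<in> P then x else p)" for p
  define r' where "r' = inv_image r f"
  have fV: "f ` V1 \<subseteq> V1" "f ` V2 \<subseteq> V2" "f ` V3 \<subseteq> V3"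
    using P x disj by (auto simp: f_def split: if_splits)
  have f_out: "f p \<in> V \<Longrightarrow> p \<in> V" for p
    using P by (auto simp: f_def split: if_splits)
  have g: "cyclic_graph r' V1 V2 V3 n"
  proof
    show "r' \<subseteq> V \<times> V" using sub f_out unfolding r'_def inv_image_def by blast
    show "sym r'" using sym unfolding r'_def sym_def inv_image_def by blast
    show "irrefl r'" using irrefl unfolding r'_def irrefl_def inv_image_def by blast
    show "trifree r' V1 V2 V3" "trifree r' V1 V1 V2" "trifree r' V2 V2 V3" "trifree r' V3 V3 V1"
      unfolding r'_def using tf123 tf112 tf223 tf331 fV by (auto intro!: trifree_inv_image)
  qed (use fin card disj in auto)
  then interpret g: cyclic_graph r' V1 V2 V3 n .
  have finT: "finite T" using P fin unfolding T_def by auto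
  have yr: "(y, x) \<notin> r" using xy(1) sym by (auto dest: symD)
  have indep: "r \<inter> T \<times> T = {}"
  proof -
    have False if "(p, q) \<in> r" "p \<in> T" "q \<in> T" for p q
    proof -
      have "q \<in> r `` {y}" using that by (auto simp: T_def)
      then have "y \<in> r `` {q}" using sym by (auto dest: symD)
      then have "y \<in> r `` {y}" using that by (auto simp: T_def)
      then show False using irrefl by (auto simp: irrefl_def)
    qed
    then show ?thesis by auto
  qed
  have c1: "card r = card (r \<inter> (- T) \<times> (- T)) + 2 * (card T * card (r `` {y}))"
    using finite_r sym indep finT by (intro card_rel_off) (auto simp: T_def)
  have xT: "x \<notin> T" using xy by (auto simp: T_def)
  have fT: "f p = x" if "p \<in> T" for p using that by (auto simp: f_def T_def)
  have fnT: "f p = p" if "p \<notin> T" for p using that by (auto simp: f_def T_def)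
  have xnT: "(x, p) \<notin> r" if "p \<in> T" for p
  proof
    assume "(x, p) \<in> r"
    then have "x \<in> r `` {p}" using sym by (auto dest: symD)
    then show False using that yr by (auto simp: T_def)
  qed
  have xx: "(x, x) \<notin> r" using irrefl by (auto simp: irrefl_def)
  \<comment> \<open>The neighbourhood of \<open>x\<close> contains neither \<open>x\<close> nor any
    vertex of \<open>T\<close>, so taking its preimage under \<open>f\<close> leaves it
    unchanged.\<close>
  have img: "r' `` {t} = r `` {x}" if "t \<in> T" for t
  proof -
    have "q \<in> r' `` {t} \<longleftrightarrow> q \<in> r `` {x}" for q
      using fT[OF that] fT[of q] fnT[of q] xnT[of q] xx
      by (cases "q \<in> T") (auto simp: r'_def)
    then show ?thesis by blast
  qed
  have indep': "r' \<inter> T \<times> T = {}"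
    using xx by (auto simp: r'_def fT)
  have c2: "card r' = card (r' \<inter> (- T) \<times> (- T)) + 2 * (card T * card (r `` {x}))"
    using g.finite_r g.sym indep' finT img by (intro card_rel_off) auto
  have "r' \<inter> (- T) \<times> (- T) = r \<inter> (- T) \<times> (- T)"
    by (auto simp: r'_def fnT)
  then have le: "card r \<le> card r'" using c1 c2 deg by simp
  have yV: "y \<in> V" using P y by auto
  have kf: "kind (f p) = kind p" for p
    using P x disj by (auto simp: f_def kind_def)
  have kP: "p \<in> P \<longleftrightarrow> kind p = kind y" for p
    using P y disj by (auto simp: kind_def)
  have fK: "key r (f p) \<noteq> key r y" for p
    using kP[of "f p"] fT[of p] fnT[of p] xT by (cases "p \<in> T") (auto simp: key_def T_def)
  \<comment> \<open>The new key of \<open>p\<close> is determined by the old key of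
    \<open>f p\<close>, and \<open>f p\<close> is never in \<open>T\<close>. Hence the old keys
    other than that of \<open>y\<close> map onto the new ones.\<close>
  have "key r' ` V \<subseteq> map_prod (vimage f) id ` (key r ` V - {key r y})"
  proof
    fix N assume "N \<in> key r' ` V"
    then obtain p where p: "p \<in> V" "N = key r' p" by auto
    have "N = map_prod (vimage f) id (key r (f p))" using p kf by (auto simp: r'_def key_def)
    moreover have "f p \<in> V" using p(1) fV by blast
    ultimately show "N \<in> map_prod (vimage f) id ` (key r ` V - {key r y})"
      using fK by blast
  qed
  then have "card (key r' ` V) \<le> card (key r ` V - {key r y})"
    using fin by (intro surj_card_le) auto
  also have "\<dots> < card (key r ` V)"
    using fin yV by (intro psubset_card_mono) auto
  finally show ?thesis using g le by blast
qed

end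


section \<open>Twin classes and the arcs between them\<close>

text \<open>If \<open>twin_closed r P\<close>, a block is either a twin class of \<open>P\<close> or empty.\<close>

definition block :: "'a rel \<Rightarrow> 'a set \<Rightarrow> 'a set \<Rightarrow> bool" where
  "block r P X \<longleftrightarrow> X \<subseteq> P \<and> (\<forall>x\<in>X. X = P - r `` {x})"

lemma block_disjoint: "block r P X \<Longrightarrow> block r P Y \<Longrightarrow> X \<inter> Y = {} \<or> X = Y"
  unfolding block_def by blast

lemma block_empty: "block r P {}"
  by (simp add: block_def)

lemma block_twins:
  assumes "twin_closed r P" "block r P X" "x \<in> X"
  shows "r `` X = r `` {x}"
proof -
  have "r `` {y} = r `` {x}" if "y \<in> X" for y
    using assms that unfolding twin_closed_def block_def by blast
  then show ?thesis using assms(3) by blast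
qed

text \<open>Two neighbours of \<open>v\<close> in \<open>Q\<close> are nonadjacent, since otherwise
  they form a forbidden triangle with \<open>v\<close>. Conversely, a vertex of \<open>Q\<close>
  nonadjacent to a neighbour of \<open>v\<close> is its twin, hence also a neighbour of
  \<open>v\<close>.\<close>

lemma block_neighbours:
  assumes "sym r" "trifree r Q Q P" "twin_closed r Q" "v \<in> P"
  shows "block r Q (r `` {v} \<inter> Q)"
  unfolding block_def
proof (intro conjI ballI equalityI subsetI)
  fix x y assume x: "x \<in> r `` {v} \<inter> Q" and y: "y \<in> r `` {v} \<inter> Q"
  then have "(x, v) \<in> r" "(y, v) \<in> r" using assms(1) by (auto dest: symD)
  then show "y \<in> Q - r `` {x}" using x y assms(2,4) by (auto simp: trifree_def)
next
  fix x y assume x: "x \<in> r `` {v} \<inter> Q" and y: "y \<in> Q - r `` {x}"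
  then have "r `` {x} = r `` {y}" using assms(3) by (auto simp: twin_closed_def)
  moreover have "v \<in> r `` {x}" using x assms(1) by (auto dest: symD)
  ultimately show "y \<in> r `` {v} \<inter> Q" using y assms(1) by (auto dest: symD)
qed auto

text \<open>This is the arc map on classes: twins have equal neighbourhoods, so any vertex of
  \<open>X\<close> determines the image. The empty block stands for a missing target and is sent to
  itself.\<close>

lemma block_Image:
  assumes "sym r" "trifree r Q Q P" "twin_closed r Q" "twin_closed r P" "block r P X"
  shows "block r Q (r `` X \<inter> Q)"
proof (cases "X = {}")
  case False
  then obtain x where x: "x \<in> X" by auto
  then have "x \<in> P" using assms(5) by (auto simp: block_def)
  then show ?thesis
    using block_neighbours[OF assms(1-3)] block_twins[OF assms(4,5) x] by simp
qed (simp add: block_empty)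

lemma ex_max_block:
  assumes "sym r" "trifree r Q Q P" "twin_closed r Q" "finite P"
  shows "\<exists>B. block r Q B \<and> (\<forall>v\<in>P. card (r `` {v} \<inter> Q) \<le> card B)"
proof (cases "P = {}")
  case True
  then show ?thesis using block_empty by auto
next
  case False
  let ?d = "\<lambda>v. card (r `` {v} \<inter> Q)"
  have "Max (?d ` P) \<in> ?d ` P" using False assms(4) by (intro Max_in) auto
  then obtain w where "w \<in> P" "?d w = Max (?d ` P)" by auto
  then have "\<forall>v\<in>P. ?d v \<le> ?d w" using assms(4) by simp
  with \<open>w \<in> P\<close> show ?thesis using block_neighbours[OF assms(1-3)] by blast
qed

section \<open>Counting pairs between and within parts\<close>

text \<open>Sum the degrees into \<open>Q\<close> over \<open>P\<close>: vertices of
  \<open>C\<close> see only the image of \<open>C\<close>, and all others see at most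
  \<open>m\<close> vertices.\<close>

lemma card_cross_le:
  assumes "finite P" "finite Q" "C \<subseteq> P" "\<forall>v\<in>P. card (r `` {v} \<inter> Q) \<le> m"
  shows "real (card (r \<inter> P \<times> Q)) \<le>
    (real (card P) - card C) * m + card C * card (r `` C \<inter> Q)"
proof -
  have fC: "finite C" "card C \<le> card P" using assms(1,3) finite_subset card_mono by blast+
  have "r \<inter> P \<times> Q = (SIGMA v:P. r `` {v} \<inter> Q)" by auto
  then have "card (r \<inter> P \<times> Q) = (\<Sum>v\<in>P. card (r `` {v} \<inter> Q))"
    using assms(1,2) by simp
  also have "\<dots> = (\<Sum>v\<in>P - C. card (r `` {v} \<inter> Q)) + (\<Sum>v\<in>C. card (r `` {v} \<inter> Q))"
    using assms(1,3) by (rule sum.subset_diff[rotated])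
  also have "(\<Sum>v\<in>P - C. card (r `` {v} \<inter> Q)) \<le> card (P - C) * m"
    using sum_bounded_above[of "P - C" "\<lambda>v. card (r `` {v} \<inter> Q)" m] assms(4) by simp
  also have "(\<Sum>v\<in>C. card (r `` {v} \<inter> Q)) \<le> card C * card (r `` C \<inter> Q)"
  proof -
    have "card (r `` {v} \<inter> Q) \<le> card (r `` C \<inter> Q)" if "v \<in> C" for v
      using that assms(2) by (intro card_mono) auto
    then show ?thesis
      using sum_bounded_above[of C "\<lambda>v. card (r `` {v} \<inter> Q)" "card (r `` C \<inter> Q)"] by simp
  qed
  finally have "real (card (r \<inter> P \<times> Q)) \<le> real (card (P - C) * m + card C * card (r `` C \<inter> Q))"
    by linarith
  moreover have "real (card (P - C)) = real (card P) - card C"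
    using fC assms(3) by (simp add: card_Diff_subset of_nat_diff)
  ultimately show ?thesis by simp
qed

text \<open>The squares \<open>X \<times> X\<close> and \<open>Y \<times> Y\<close> are disjoint and
  contain no pair of \<open>r\<close>.\<close>

lemma card_within_le:
  assumes "finite P" "block r P X" "block r P Y" "X \<inter> Y = {}"
  shows "real (card (r \<inter> P \<times> P)) \<le> (real (card P))\<^sup>2 - (real (card X))\<^sup>2 - (real (card Y))\<^sup>2"
proof -
  have XY: "X \<subseteq> P" "Y \<subseteq> P" using assms(2,3) by (auto simp: block_def)
  then have f: "finite X" "finite Y" using assms(1) finite_subset by blast+
  have d: "X \<times> X \<inter> Y \<times> Y = {}" using assms(4) by auto
  have ind: "r \<inter> X \<times> X = {}" "r \<inter> Y \<times> Y = {}"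
    using assms(2,3) unfolding block_def by blast+
  have "card (r \<inter> P \<times> P) + card (X \<times> X \<union> Y \<times> Y) = card (r \<inter> P \<times> P \<union> (X \<times> X \<union> Y \<times> Y))"
    using assms(1) f ind by (intro card_Un_disjoint[symmetric]) auto
  also have "\<dots> \<le> card (P \<times> P)" using assms(1) XY by (intro card_mono) auto
  also have "card (X \<times> X \<union> Y \<times> Y) = card (X \<times> X) + card (Y \<times> Y)"
    using f d by (intro card_Un_disjoint) auto
  finally have "real (card (r \<inter> P \<times> P) + (card X * card X + card Y * card Y)) \<le> real (card P * card P)"
    unfolding card_cartesian_product by linarith
  then show ?thesis by (simp add: power2_eq_square)
qed

section \<open>The two quadratic inequalities\<close>

lemma chain_inequality:
  fixes a a' b b' c c' n :: real
  assumes "0 \<le> a'" "a' \<le> a" "0 \<le> b'" "b' \<le> b" "0 \<le> c" "c \<le> n"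
  shows "3 * n\<^sup>2 - a\<^sup>2 - a'\<^sup>2 - b\<^sup>2 - b'\<^sup>2 - c\<^sup>2 - c'\<^sup>2 +
    2 * ((n - c) * b + c * b' + ((n - b') * a + b' * a') + ((n - a') * c + a' * c')) \<le> 5 * n\<^sup>2"
    (is "?L \<le> _")
\<comment> \<open>In each case the slack is an explicit sum of squares and nonnegative products; the
  split fixes the sign of the mixed term containing \<open>c - b'\<close> or
  \<open>b' - c\<close>.\<close>
proof (cases "b' \<le> c")
  case True
  have "0 \<le> a' * (c - b')" "0 \<le> b' * (b - b')" "0 \<le> b' * b'" using assms True by auto
  moreover have "5 * n\<^sup>2 - ?L = (a' - c')\<^sup>2 + 2 * (a' * (c - b')) + (a - (n - b'))\<^sup>2
      + (c - (n - b + b'))\<^sup>2 + 2 * (b' * (b - b')) + b' * b'"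
    by (simp add: power2_eq_square algebra_simps)
  ultimately show ?thesis
    by (smt (verit) zero_le_power2)
next
  case False
  have "0 \<le> (a - a') * (b' - c)" "0 \<le> c * (n - c)" using assms False by auto
  moreover have "5 * n\<^sup>2 - ?L = (a' - c')\<^sup>2 + 2 * ((a - a') * (b' - c)) + (a - (n - c))\<^sup>2
      + (b - (n - c))\<^sup>2 + (b' - c)\<^sup>2 + 2 * (c * (n - c))"
    by (simp add: power2_eq_square algebra_simps)
  ultimately show ?thesis
    by (smt (verit) zero_le_power2)
qed

lemma three_gaps_inequality:
  fixes a a' b b' c c' n :: real
  assumes "0 \<le> a" "a \<le> n" "0 \<le> b" "b \<le> n" "0 \<le> c" "c \<le> n"
  shows "3 * n\<^sup>2 - a\<^sup>2 - a'\<^sup>2 - b\<^sup>2 - b'\<^sup>2 - c\<^sup>2 - c'\<^sup>2 +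
    2 * ((n - c) * b + c * b' + ((n - b) * a + b * a') + ((n - a) * c + a * c')) \<le> 5 * n\<^sup>2"
    (is "?L \<le> _")
proof -
  \<comment> \<open>The expression is affine in \<open>c\<close>, with values
    \<open>(n - a) * (n - b)\<close> at \<open>c = 0\<close> and \<open>a * b\<close> at
    \<open>c = n\<close>, both nonnegative.\<close>
  have "0 \<le> (n - a) * (n - b) - c * (n - a - b)"
  proof (cases "n - a - b \<le> 0")
    case True
    then have "0 \<le> (n - a) * (n - b)" "c * (n - a - b) \<le> 0"
      using assms by (auto simp: mult_nonneg_nonpos)
    then show ?thesis by linarith
  next
    case False
    then have "c * (n - a - b) \<le> n * (n - a - b)" using assms by (intro mult_right_mono) auto
    moreover have "(n - a) * (n - b) - n * (n - a - b) = a * b" by (simp add: algebra_simps)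
    moreover have "0 \<le> a * b" using assms by simp
    ultimately show ?thesis by linarith
  qed
  moreover have "5 * n\<^sup>2 - ?L = 2 * ((n - a) * (n - b) - c * (n - a - b))
      + (b' - c)\<^sup>2 + (a' - b)\<^sup>2 + (c' - a)\<^sup>2"
    by (simp add: power2_eq_square algebra_simps)
  ultimately show ?thesis
    by (smt (verit) zero_le_power2)
qed

section \<open>The bound when all parts consist of twin classes\<close>

locale twin_graph = cyclic_graph +
  assumes twins: "twin_closed r V1" "twin_closed r V2" "twin_closed r V3"

lemma twin_graph_rotate: "twin_graph r V1 V2 V3 n \<Longrightarrow> twin_graph r V2 V3 V1 n"
  by (simp add: twin_graph_def twin_graph_axioms_def cyclic_graph_rotate)

definition top_block :: "'a rel \<Rightarrow> 'a set \<Rightarrow> 'a set \<Rightarrow> 'a set \<Rightarrow> bool" where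
  "top_block r P Q B \<longleftrightarrow> block r Q B \<and> (\<forall>v\<in>P. card (r `` {v} \<inter> Q) \<le> card B)"

context twin_graph
begin

lemma block_Image1: "block r V2 X \<Longrightarrow> block r V1 (r `` X \<inter> V1)"
  and block_Image2: "block r V3 X \<Longrightarrow> block r V2 (r `` X \<inter> V2)"
  and block_Image3: "block r V1 X \<Longrightarrow> block r V3 (r `` X \<inter> V3)"
  using block_Image sym twins tf112 tf223 tf331 by metis+

text \<open>Arcs between classes are complete, so one vertex from each class on a directed 3-cycle
  gives a triangle meeting all three parts.\<close>

lemma no_cycle:
  assumes X: "block r V1 X" and Z: "block r V3 Z" and Y: "block r V2 Y"
    and ne: "r `` X \<inter> V3 \<inter> Z \<noteq> {}" "r `` Z \<inter> V2 \<inter> Y \<noteq> {}" "r `` Y \<inter> V1 \<inter> X \<noteq> {}"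
  shows False
proof -
  obtain z where z: "z \<in> r `` X" "z \<in> Z" "z \<in> V3" using ne(1) by auto
  obtain y where y: "y \<in> r `` Z" "y \<in> Y" "y \<in> V2" using ne(2) by auto
  obtain x where x: "x \<in> r `` Y" "x \<in> X" "x \<in> V1" using ne(3) by auto
  have "(x, z) \<in> r" using block_twins[OF twins(1) X x(2)] z(1) by auto
  moreover have "(z, y) \<in> r" using block_twins[OF twins(3) Z z(2)] y(1) by auto
  moreover have "(y, x) \<in> r" using block_twins[OF twins(2) Y y(2)] x(1) by auto
  ultimately show False
    using tf123 sym x y z unfolding trifree_def by (meson symD)
qed

text \<open>Inside each part the two classes remove their squares; between parts, symmetry lets each
  pair be counted in the direction of the arcs and doubled.\<close>

lemma card_r_le:
  assumes "block r V1 A" "block r V1 A'" "A \<inter> A' = {}"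
    and "block r V2 B" "block r V2 B'" "B \<inter> B' = {}"
    and "block r V3 C" "block r V3 C'" "C \<inter> C' = {}"
  shows "real (card r) \<le> 3 * (real n)\<^sup>2
    - (real (card A))\<^sup>2 - (real (card A'))\<^sup>2
    - (real (card B))\<^sup>2 - (real (card B'))\<^sup>2
    - (real (card C))\<^sup>2 - (real (card C'))\<^sup>2
    + 2 * (real (card (r \<inter> V3 \<times> V2)) + real (card (r \<inter> V2 \<times> V1)) + real (card (r \<inter> V1 \<times> V3)))"
proof -
  have conv: "card (r \<inter> Q \<times> P) = card (r \<inter> P \<times> Q)" for P Q
  proof -
    have "r \<inter> Q \<times> P = (r \<inter> P \<times> Q)\<inverse>" using sym by (auto dest: symD)
    then show ?thesis by (metis card_inverse)
  qed
  let ?w = "r \<inter> V1 \<times> V1 \<union> (r \<inter> V2 \<times> V2 \<union> r \<inter> V3 \<times> V3)"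
  let ?u = "r \<inter> V3 \<times> V2 \<union> (r \<inter> V2 \<times> V1 \<union> r \<inter> V1 \<times> V3)"
  let ?d = "r \<inter> V2 \<times> V3 \<union> (r \<inter> V1 \<times> V2 \<union> r \<inter> V3 \<times> V1)"
  have "r = ?w \<union> (?u \<union> ?d)" using sub by auto
  then have "card r = card (?w \<union> (?u \<union> ?d))" by (rule arg_cong)
  also have "\<dots> \<le> card ?w + (card ?u + card ?d)"
    by (meson add_left_mono card_Un_le order_trans)
  also have "card ?w \<le> card (r \<inter> V1 \<times> V1) + (card (r \<inter> V2 \<times> V2) + card (r \<inter> V3 \<times> V3))"
    by (meson add_left_mono card_Un_le order_trans)
  also have "card ?u \<le> card (r \<inter> V3 \<times> V2) + (card (r \<inter> V2 \<times> V1) + card (r \<inter> V1 \<times> V3))"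
    by (meson add_left_mono card_Un_le order_trans)
  also have "card ?d \<le> card (r \<inter> V2 \<times> V3) + (card (r \<inter> V1 \<times> V2) + card (r \<inter> V3 \<times> V1))"
    by (meson add_left_mono card_Un_le order_trans)
  finally have "real (card r) \<le> real (card (r \<inter> V1 \<times> V1)) + real (card (r \<inter> V2 \<times> V2))
      + real (card (r \<inter> V3 \<times> V3))
      + 2 * (real (card (r \<inter> V3 \<times> V2)) + real (card (r \<inter> V2 \<times> V1)) + real (card (r \<inter> V1 \<times> V3)))"
    using conv[of V2 V3] conv[of V1 V2] conv[of V3 V1] by simp
  then show ?thesis
    using card_within_le[OF fin(1) assms(1-3)] card_within_le[OF fin(2) assms(4-6)]
      card_within_le[OF fin(3) assms(7-9)] card by simp
qed

lemma card_block_le: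
  "block r V1 X \<Longrightarrow> card X \<le> n" "block r V2 X \<Longrightarrow> card X \<le> n" "block r V3 X \<Longrightarrow> card X \<le> n"
  using fin card card_mono unfolding block_def by metis+

lemma chain_bound:
  assumes A: "top_block r V2 V1 A" and B: "top_block r V3 V2 B" and C: "top_block r V1 V3 C"
    and gap: "r `` C \<inter> V2 \<inter> B = {}"
    and gap': "r `` (r `` C \<inter> V2) \<inter> V1 \<inter> A = {}"
  shows "card r \<le> 5 * n\<^sup>2"
proof -
  define B' where "B' = r `` C \<inter> V2"
  define A' where "A' = r `` B' \<inter> V1"
  define C' where "C' = r `` A' \<inter> V3"
  have bl: "block r V1 A" "block r V2 B" "block r V3 C" using A B C by (auto simp: top_block_def)
  have bl': "block r V2 B'" "block r V1 A'" "block r V3 C'"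
    using bl unfolding B'_def A'_def C'_def by (blast intro: block_Image1 block_Image2 block_Image3)+
  \<comment> \<open>If \<open>C'\<close> met \<open>C\<close>, the path
    \<open>C \<rightarrow> B' \<rightarrow> A' \<rightarrow> C\<close> would close a cycle.\<close>
  have "C \<inter> C' = {}"
  proof (rule ccontr)
    assume ne: "C \<inter> C' \<noteq> {}"
    then have "A' \<noteq> {}" by (auto simp: C'_def)
    then have "B' \<noteq> {}" by (auto simp: A'_def)
    have "r `` C \<inter> V2 \<inter> B' \<noteq> {}" "r `` B' \<inter> V1 \<inter> A' \<noteq> {}" "r `` A' \<inter> V3 \<inter> C \<noteq> {}"
      using ne \<open>A' \<noteq> {}\<close> \<open>B' \<noteq> {}\<close> by (auto simp: B'_def A'_def C'_def)
    then show False using no_cycle[OF bl'(2) bl(3) bl'(1)] by blast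
  qed
  moreover have "A \<inter> A' = {}" "B \<inter> B' = {}"
    using gap gap' by (auto simp: A'_def B'_def)
  ultimately have "real (card r) \<le> 3 * (real n)\<^sup>2
    - (real (card A))\<^sup>2 - (real (card A'))\<^sup>2
    - (real (card B))\<^sup>2 - (real (card B'))\<^sup>2
    - (real (card C))\<^sup>2 - (real (card C'))\<^sup>2
    + 2 * (real (card (r \<inter> V3 \<times> V2)) + real (card (r \<inter> V2 \<times> V1)) + real (card (r \<inter> V1 \<times> V3)))"
    using bl bl' by (intro card_r_le) auto
  moreover have "real (card (r \<inter> V3 \<times> V2)) \<le> (real n - card C) * card B + card C * card B'"
    using card_cross_le[of V3 V2 C r "card B"] fin card bl B by (auto simp: B'_def block_def top_block_def)
  \<comment> \<open>The class singled out in \<open>V2\<close> is \<open>B'\<close>, whose image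
    \<open>A'\<close> is the next class on the path, rather than \<open>B\<close>; likewise
    \<open>A'\<close> is singled out in \<open>V1\<close>.\<close>
  moreover have "real (card (r \<inter> V2 \<times> V1)) \<le> (real n - card B') * card A + card B' * card A'"
    using card_cross_le[of V2 V1 B' r "card A"] fin card bl' A by (auto simp: A'_def block_def top_block_def)
  moreover have "real (card (r \<inter> V1 \<times> V3)) \<le> (real n - card A') * card C + card A' * card C'"
    using card_cross_le[of V1 V3 A' r "card C"] fin card bl' C by (auto simp: C'_def block_def top_block_def)
  moreover have "card B' \<le> card B"
  proof (cases "C = {}")
    case False
    then obtain x where x: "x \<in> C" by auto
    then have "x \<in> V3" using bl by (auto simp: block_def)
    then show ?thesis using B block_twins[OF twins(3) bl(3) x] by (simp add: top_block_def B'_def)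
  qed (simp add: B'_def)
  moreover have "card A' \<le> card A"
  proof (cases "B' = {}")
    case False
    then obtain x where x: "x \<in> B'" by auto
    then have "x \<in> V2" using bl' by (auto simp: block_def)
    then show ?thesis using A block_twins[OF twins(2) bl'(1) x] by (simp add: top_block_def A'_def)
  qed (simp add: A'_def)
  moreover have "card C \<le> n" using bl card_block_le by blast
  ultimately have "real (card r) \<le> 5 * (real n)\<^sup>2"
    using chain_inequality[of "card A'" "card A" "card B'" "card B" "card C" n "card C'"] by simp
  also have "\<dots> = real (5 * n\<^sup>2)" by simp
  finally show ?thesis by linarith
qed

text \<open>Here \<open>A'\<close>, \<open>B'\<close>, \<open>C'\<close> are the images of
  \<open>B\<close>, \<open>C\<close>, \<open>A\<close> themselves, and each gap makes an image
  disjoint from the top block of its part.\<close>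

lemma three_gaps_bound:
  assumes A: "top_block r V2 V1 A" and B: "top_block r V3 V2 B" and C: "top_block r V1 V3 C"
    and gaps: "r `` C \<inter> V2 \<inter> B = {}" "r `` B \<inter> V1 \<inter> A = {}" "r `` A \<inter> V3 \<inter> C = {}"
  shows "card r \<le> 5 * n\<^sup>2"
proof -
  define B' where "B' = r `` C \<inter> V2"
  define A' where "A' = r `` B \<inter> V1"
  define C' where "C' = r `` A \<inter> V3"
  have bl: "block r V1 A" "block r V2 B" "block r V3 C" using A B C by (auto simp: top_block_def)
  have bl': "block r V2 B'" "block r V1 A'" "block r V3 C'"
    using bl unfolding B'_def A'_def C'_def by (blast intro: block_Image1 block_Image2 block_Image3)+
  have "A \<inter> A' = {}" "B \<inter> B' = {}" "C \<inter> C' = {}"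
    using gaps by (auto simp: A'_def B'_def C'_def)
  then have "real (card r) \<le> 3 * (real n)\<^sup>2
    - (real (card A))\<^sup>2 - (real (card A'))\<^sup>2
    - (real (card B))\<^sup>2 - (real (card B'))\<^sup>2
    - (real (card C))\<^sup>2 - (real (card C'))\<^sup>2
    + 2 * (real (card (r \<inter> V3 \<times> V2)) + real (card (r \<inter> V2 \<times> V1)) + real (card (r \<inter> V1 \<times> V3)))"
    using bl bl' by (intro card_r_le) auto
  moreover have "real (card (r \<inter> V3 \<times> V2)) \<le> (real n - card C) * card B + card C * card B'"
    using card_cross_le[of V3 V2 C r "card B"] fin card bl B by (auto simp: B'_def block_def top_block_def)
  moreover have "real (card (r \<inter> V2 \<times> V1)) \<le> (real n - card B) * card A + card B * card A'"
    using card_cross_le[of V2 V1 B r "card A"] fin card bl A by (auto simp: A'_def block_def top_block_def)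
  moreover have "real (card (r \<inter> V1 \<times> V3)) \<le> (real n - card A) * card C + card A * card C'"
    using card_cross_le[of V1 V3 A r "card C"] fin card bl C by (auto simp: C'_def block_def top_block_def)
  moreover have "card A \<le> n" "card B \<le> n" "card C \<le> n" using bl card_block_le by blast+
  ultimately have "real (card r) \<le> 5 * (real n)\<^sup>2"
    using three_gaps_inequality[of "card A" n "card B" "card C" "card A'" "card B'" "card C'"] by simp
  also have "\<dots> = real (5 * n\<^sup>2)" by simp
  finally show ?thesis by linarith
qed

text \<open>If the path from \<open>C\<close> avoids \<open>A\<close>, \<open>chain_bound\<close>
  applies. Otherwise \<open>B' \<rightarrow> A\<close> rules out \<open>A \<rightarrow> C\<close>,
  and the path from \<open>A\<close> is tried in the rotated graph. If this fails too,
  \<open>C' \<rightarrow> B\<close> rules out \<open>B \<rightarrow> A\<close>, so all three arcs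
  are missing.\<close>

lemma gap_bound:
  assumes A: "top_block r V2 V1 A" and B: "top_block r V3 V2 B" and C: "top_block r V1 V3 C"
    and gap: "r `` C \<inter> V2 \<inter> B = {}"
  shows "card r \<le> 5 * n\<^sup>2"
proof -
  interpret g2: twin_graph r V2 V3 V1 n by (rule twin_graph_rotate) (rule twin_graph_axioms)
  have bl: "block r V1 A" "block r V2 B" "block r V3 C" using A B C by (auto simp: top_block_def)
  define B' where "B' = r `` C \<inter> V2"
  define C' where "C' = r `` A \<inter> V3"
  have bl': "block r V2 B'" "block r V3 C'"
    unfolding B'_def C'_def using bl by (auto intro: block_Image2 block_Image3)
  show ?thesis
  proof (cases "r `` B' \<inter> V1 \<inter> A = {}")
    case True
    then show ?thesis using chain_bound[OF A B C gap] by (simp add: B'_def)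
  next
    case BA: False
    then have "B' \<noteq> {}" by auto
    then have CB: "r `` C \<inter> V2 \<inter> B' \<noteq> {}" by (auto simp: B'_def)
    have AC: "r `` A \<inter> V3 \<inter> C = {}"
      using no_cycle[OF bl(1) bl(3) bl'(1) _ CB BA] by blast
    show ?thesis
    proof (cases "r `` C' \<inter> V2 \<inter> B = {}")
      case True
      then show ?thesis using g2.chain_bound[OF B C A AC] by (simp add: C'_def)
    next
      case CB': False
      then have "C' \<noteq> {}" by auto
      then have "r `` A \<inter> V3 \<inter> C' \<noteq> {}" by (auto simp: C'_def)
      then have "r `` B \<inter> V1 \<inter> A = {}"
        using no_cycle[OF bl(1) bl'(2) bl(2) _ CB'] by blast
      then show ?thesis using three_gaps_bound[OF A B C gap _ AC] by blast
    qed
  qed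
qed

lemma twin_graph_bound: "card r \<le> 5 * n\<^sup>2"
proof -
  interpret g2: twin_graph r V2 V3 V1 n by (rule twin_graph_rotate) (rule twin_graph_axioms)
  interpret g3: twin_graph r V3 V1 V2 n by (rule twin_graph_rotate) (rule g2.twin_graph_axioms)
  obtain A where A: "top_block r V2 V1 A"
    using ex_max_block[OF sym tf112 twins(1) fin(2)] by (auto simp: top_block_def)
  obtain B where B: "top_block r V3 V2 B"
    using ex_max_block[OF sym tf223 twins(2) fin(3)] by (auto simp: top_block_def)
  obtain C where C: "top_block r V1 V3 C"
    using ex_max_block[OF sym tf331 twins(3) fin(1)] by (auto simp: top_block_def)
  have bl: "block r V1 A" "block r V2 B" "block r V3 C" using A B C by (auto simp: top_block_def)
  consider "r `` C \<inter> V2 \<inter> B = {}" | "r `` B \<inter> V1 \<inter> A = {}" | "r `` A \<inter> V3 \<inter> C = {}"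
    using no_cycle[OF bl(1,3,2)] by blast
  \<comment> \<open>Each case uses the rotation that puts the missing arc in the place of
    \<open>C \<rightarrow> B\<close>.\<close>
  then show ?thesis
  proof cases
    case 1 then show ?thesis using gap_bound[OF A B C] by blast
  next
    case 2 then show ?thesis using g3.gap_bound[OF C A B] by blast
  next
    case 3 then show ?thesis using g2.gap_bound[OF B C A] by blast
  qed
qed

end

section \<open>Reduction to twin classes and return to edge sets\<close>

text \<open>Symmetrization never lowers \<open>card r\<close> and strictly lowers the number of
  keys, so induction on that number ends at a twin graph.\<close>

lemma cyclic_graph_bound: "cyclic_graph r V1 V2 V3 n \<Longrightarrow> card r \<le> 5 * n\<^sup>2"
proof (induction "card (cyclic_graph.key V1 V2 V3 r ` (V1 \<union> V2 \<union> V3))" arbitrary: r rule: less_induct)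
  case less
  interpret cyclic_graph r V1 V2 V3 n by (rule less.prems)
  show ?case
  proof (cases "twin_closed r V1 \<and> twin_closed r V2 \<and> twin_closed r V3")
    case True
    then interpret twin_graph r V1 V2 V3 n by unfold_locales auto
    show ?thesis by (rule twin_graph_bound)
  next
    case False
    then obtain P x y where P: "P \<in> {V1, V2, V3}" "x \<in> P" "y \<in> P"
      and xy: "(x, y) \<notin> r" "r `` {x} \<noteq> r `` {y}"
      unfolding twin_closed_def by blast
    have yx: "(y, x) \<notin> r" using xy(1) sym by (auto dest: symD)
    obtain r' where "cyclic_graph r' V1 V2 V3 n" "card r \<le> card r'"
      "card (key r' ` V) < card (key r ` V)"
      \<comment> \<open>Either vertex may have the larger degree, so both orders are
        supplied.\<close>
      using symmetrize[OF P xy] symmetrize[OF P(1,3,2) yx xy(2)[symmetric]] by (meson nle_le)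
    then show ?thesis using less.hyps[of r'] by simp
  qed
qed

lemma card_edge_pairs:
  assumes "finite E" "\<forall>e\<in>E. card e = 2"
  shows "card {(x, y). {x, y} \<in> E} = 2 * card E"
proof -
  let ?p = "\<lambda>e. {(x, y). {x, y} = e}"
  have p: "card (?p e) = 2 \<and> finite (?p e)" if "e \<in> E" for e
  proof -
    have "card e = 2" using assms(2) that by blast
    then obtain u v where e: "e = {u, v}" "u \<noteq> v" unfolding card_2_iff by blast
    have "?p e = {(u, v), (v, u)}" unfolding e(1) doubleton_eq_iff by blast
    then show ?thesis using e(2) by simp
  qed
  have "{(x, y). {x, y} \<in> E} = (\<Union>e\<in>E. ?p e)" by auto
  then have "card {(x, y). {x, y} \<in> E} = (\<Sum>e\<in>E. card (?p e))"
    using assms(1) p by (simp only:) (intro card_UN_disjoint, auto)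
  then show ?thesis using p by simp
qed

lemma cyclic_graph_edges:
  assumes "simple_graph V E" "tripartition V V1 V2 V3"
    and "card V1 = n" "card V2 = n" "card V3 = n"
    and ctf: "cyclically_triangle_free E V1 V2 V3"
  shows "cyclic_graph {(x, y). {x, y} \<in> E} V1 V2 V3 n"
proof -
  let ?r = "{(x, y). {x, y} \<in> E}"
  have V: "V = V1 \<union> V2 \<union> V3" "V1 \<inter> V2 = {}" "V1 \<inter> V3 = {}" "V2 \<inter> V3 = {}"
    using assms(2) by (auto simp: tripartition_def)
  have E: "finite V" "e \<in> E \<Longrightarrow> e \<subseteq> V \<and> card e = 2" for e
    using assms(1) by (auto simp: simple_graph_def nsets_def)
  have ne: "x \<noteq> y" if "(x, y) \<in> ?r" for x y
    using that E(2)[of "{x, y}"] by auto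
  have tri: "spans_triangle E {x, y, z}"
    if "(x, y) \<in> ?r" "(y, z) \<in> ?r" "(x, z) \<in> ?r" for x y z
    using that ne[of x y] ne[of y z] ne[of x z]
    by (auto simp: spans_triangle_def clique_def insert_commute)
  have free: False if "spans_triangle E T"
    "card (T \<inter> V1) = 1 \<and> card (T \<inter> V2) = 1 \<and> card (T \<inter> V3) = 1 \<or>
     card (T \<inter> V1) = 2 \<and> card (T \<inter> V2) = 1 \<or>
     card (T \<inter> V2) = 2 \<and> card (T \<inter> V3) = 1 \<or>
     card (T \<inter> V3) = 2 \<and> card (T \<inter> V1) = 1" for T
    using ctf that unfolding cyclically_triangle_free_def by blast
  show ?thesis
  proof
    show "finite V1" "finite V2" "finite V3" using E(1) V(1) by auto
    show "?r \<subseteq> (V1 \<union> V2 \<union> V3) \<times> (V1 \<union> V2 \<union> V3)" using E(2) V(1) by blast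
    show "sym ?r" by (auto simp: sym_def insert_commute)
    show "irrefl ?r" unfolding irrefl_def using ne by blast
    show "trifree ?r V1 V2 V3" unfolding trifree_def
    proof (intro ballI notI)
      fix x y z assume v: "x \<in> V1" "y \<in> V2" "z \<in> V3"
        and xyz: "(x, y) \<in> ?r \<and> (y, z) \<in> ?r \<and> (x, z) \<in> ?r"
      have "{x, y, z} \<inter> V1 = {x}" "{x, y, z} \<inter> V2 = {y}" "{x, y, z} \<inter> V3 = {z}"
        using v V by auto
      then have "card ({x, y, z} \<inter> V1) = 1" "card ({x, y, z} \<inter> V2) = 1" "card ({x, y, z} \<inter> V3) = 1"
        by simp_all
      then show False using free[OF tri[of x y z]] xyz by blast
    qed
    \<comment> \<open>The three forbidden types with two vertices in one part are handled together;
      \<open>x \<noteq> y\<close> makes the intersection with \<open>P\<close> have size 2.\<close>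
    have two: False if "(x, y) \<in> ?r \<and> (y, z) \<in> ?r \<and> (x, z) \<in> ?r" "x \<in> P" "y \<in> P" "z \<in> Q"
      "(P, Q) \<in> {(V1, V2), (V2, V3), (V3, V1)}" for x y z P Q
    proof -
      have "P \<inter> Q = {}" using that V by auto
      then have "{x, y, z} \<inter> P = {x, y}" "{x, y, z} \<inter> Q = {z}" using that by auto
      then have "card ({x, y, z} \<inter> P) = 2" "card ({x, y, z} \<inter> Q) = 1"
        using that(1) ne[of x y] by simp_all
      then show False using free[OF tri[of x y z]] that(1,5) by blast
    qed
    show "trifree ?r V1 V1 V2" "trifree ?r V2 V2 V3" "trifree ?r V3 V3 V1"
      unfolding trifree_def using two by blast+
  qed (use assms V in auto)
qed

theorem theorem2p4:
  fixes V V1 V2 V3 :: "'a set" and E :: "'a set set" and n :: nat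
  assumes "simple_graph V E"
    and "tripartition V V1 V2 V3"
    and "card V1 = n" and "card V2 = n" and "card V3 = n"
    and "cyclically_triangle_free E V1 V2 V3"
  shows "real (card E) \<le> 5 * (real n)\<^sup>2 / 2 + 5 * real n"
proof -
  have "finite V" "E \<subseteq> nsets V 2" using assms(1) by (auto simp: simple_graph_def)
  then have "finite E" "\<forall>e\<in>E. card e = 2"
    using finite_imp_finite_nsets finite_subset by (blast, auto simp: nsets_def)
  then have "2 * card E \<le> 5 * n\<^sup>2"
    using cyclic_graph_bound[OF cyclic_graph_edges[OF assms]] card_edge_pairs by metis
  then have "real (2 * card E) \<le> real (5 * n\<^sup>2)" by (rule of_nat_mono)
  then show ?thesis by simp
qed

end
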